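(* There exists a universal constant $c>0$ such that for every $n\ge1$ and all increasing functions $f,g:\{-1,1\}^n\to\{0,1\}$, $$ \mathrm{Cor}(f,g)\ \ge\ c\,\min\left(\frac{\mathcal{M}_1(f,g)}{\sqrt{\log\left(\frac{e}{\mathcal{M}_1(f,g)}\right)}},\ \frac{\mathcal{M}_1(f,g)^2}{|\mathcal{M}_2(f,g)|}\right), $$ where $$ \mathcal{M}_1(f,g)=\sum_{i=1}^n \mathrm{I}_i(f)\,\mathrm{I}_i(g),\qquad \mathcal{M}_2(f,g)=\langle \mathrm{V}(f),\mathrm{V}(g)\rangle_{HS}. $$
   Context: Let $\mu$ be the uniform probability measure on $\{-1,1\}^n$ and $\mathbb{E}$ the expectation with respect to $\mu$. For $f:\{-1,1\}^n\to\mathbb{R}$ and $i\in\{1,\dots,n\}$, the discrete derivative is $\partial_i f(x)=\frac12\big(f(x;x_i\to 1)-f(x;x_i\to -1)\big)$, where $(x;x_i\to a)$ denotes $x$ with its $i$-th coordinate replaced by $a$. A function $f:\{-1,1\}^n\to\{0,1\}$ is increasing if $\partial_i f(x)\ge 0$ for all $i$ and $x$. The influence of the $i$-th coordinate is $\mathrm{I}_i(f)=2\int|\partial_i f(x)|\,d\mu(x)$. The matrix $\mathrm{V}(f)\in\mathbb{R}^{n\times n}$ is defined by $\mathrm{V}(f)_{i,j}=\mathbb{E}[\partial_i\partial_j f]$ (the second-order Fourier coefficients of $f$; its diagonal is zero), and $\langle A,B\rangle_{HS}=\sum_{i,j}A_{i,j}B_{i,j}$. The correlation is $\mathrm{Cor}(f,g)=\mathbb{E}[fg]-\mathbb{E}[f]\,\mathbb{E}[g]$.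 Here $\log$ is the natural logarithm. Conventions: the right-hand side is $0$ if $\mathcal{M}_1(f,g)=0$; if $\mathcal{M}_1(f,g)>0$ and $\mathcal{M}_2(f,g)=0$, the second term of the minimum is $+\infty$. The constant $c$ does not depend on $n,f,g$. *)

theory Defs
  imports "HOL-Probability.Probability"
begin

text \<open>
  Points of the cube are functions on \<open>nat\<close> that are \<open>undefined\<close> outside \<open>{1..n}\<close>, so that
  the dimension is an ordinary number and constants can be chosen independently of it.
  Functions on the cube are total on \<open>nat \<Rightarrow> real\<close>; for coordinates in \<open>{1..n}\<close>, the notions
  below depend only on their values on \<open>cube n\<close>.
\<close>

definition cube :: "nat \<Rightarrow> (nat \<Rightarrow> real) set" where
  "cube n = {1..n} \<rightarrow>\<^sub>E {-1, 1}"

definition cube_exp :: "nat \<Rightarrow> ((nat \<Rightarrow> real) \<Rightarrow> real) \<Rightarrow> real" where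
  "cube_exp n f = measure_pmf.expectation (pmf_of_set (cube n)) f"

definition discrete_deriv :: "nat \<Rightarrow> ((nat \<Rightarrow> real) \<Rightarrow> real) \<Rightarrow> (nat \<Rightarrow> real) \<Rightarrow> real" where
  "discrete_deriv i f x = (f (x(i := 1)) - f (x(i := -1))) / 2"

definition cube_increasing :: "nat \<Rightarrow> ((nat \<Rightarrow> real) \<Rightarrow> real) \<Rightarrow> bool" where
  "cube_increasing n f \<longleftrightarrow> (\<forall>i\<in>{1..n}. \<forall>x\<in>cube n. discrete_deriv i f x \<ge> 0)"

definition influence :: "nat \<Rightarrow> nat \<Rightarrow> ((nat \<Rightarrow> real) \<Rightarrow> real) \<Rightarrow> real" where
  "influence n i f = 2 * cube_exp n (\<lambda>x. \<bar>discrete_deriv i f x\<bar>)"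

definition V :: "nat \<Rightarrow> ((nat \<Rightarrow> real) \<Rightarrow> real) \<Rightarrow> nat \<Rightarrow> nat \<Rightarrow> real" where
  "V n f i j = cube_exp n (discrete_deriv i (discrete_deriv j f))"

definition hs_inner :: "nat \<Rightarrow> (nat \<Rightarrow> nat \<Rightarrow> real) \<Rightarrow> (nat \<Rightarrow> nat \<Rightarrow> real) \<Rightarrow> real" where
  "hs_inner n A B = (\<Sum>i=1..n. \<Sum>j=1..n. A i j * B i j)"

definition Cor :: "nat \<Rightarrow> ((nat \<Rightarrow> real) \<Rightarrow> real) \<Rightarrow> ((nat \<Rightarrow> real) \<Rightarrow> real) \<Rightarrow> real" where
  "Cor n f g = cube_exp n (\<lambda>x. f x * g x) - cube_exp n f * cube_exp n g"

definition M1 :: "nat \<Rightarrow> ((nat \<Rightarrow> real) \<Rightarrow> real) \<Rightarrow> ((nat \<Rightarrow> real) \<Rightarrow> real) \<Rightarrow> real" where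
  "M1 n f g = (\<Sum>i=1..n. influence n i f * influence n i g)"

definition M2 :: "nat \<Rightarrow> ((nat \<Rightarrow> real) \<Rightarrow> real) \<Rightarrow> ((nat \<Rightarrow> real) \<Rightarrow> real) \<Rightarrow> real" where
  "M2 n f g = hs_inner n (V n f) (V n g)"

lemma finite_cube: "finite (cube n)"
  by (simp add: cube_def finite_PiE)

lemma card_cube: "card (cube n) = 2 ^ n"
  by (simp add: cube_def card_PiE numeral_2_eq_2)

lemma cube_nonempty: "cube n \<noteq> {}"
  by (simp add: cube_def PiE_eq_empty_iff)

lemma cube_exp_eq_sum: "cube_exp n f = (\<Sum>x\<in>cube n. f x) / 2 ^ n"
  by (simp add: cube_exp_def integral_pmf_of_set finite_cube cube_nonempty card_cube)

lemma fun_upd_in_cube: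
  "x \<in> cube n \<Longrightarrow> i \<in> {1..n} \<Longrightarrow> a \<in> {-1, 1} \<Longrightarrow> x(i := a) \<in> cube n"
  by (auto simp: cube_def PiE_iff extensional_def)

lemma V_diag: "V n f i i = 0"
proof -
  have "discrete_deriv i (discrete_deriv i f) = (\<lambda>x. 0)"
    by (simp add: fun_eq_iff discrete_deriv_def)
  then show ?thesis
    by (simp add: V_def cube_exp_def)
qed

end

theory Submission
  imports Defs
begin

text \<open>
  Let \<open>\<phi>(\<rho>) = \<E>[f T\<^sub>\<rho> g]\<close> and \<open>h = \<phi>'\<close>, so that \<open>h(\<rho>) = \<Sum>\<^sub>i \<E>[\<partial>\<^sub>i f T\<^sub>\<rho> \<partial>\<^sub>i g] \<ge> 0\<close>,
  \<open>Cor f g = \<phi>(1) - \<phi>(0)\<close>, \<open>h(0) = M\<^sub>1 / 4\<close> and \<open>h'(0) = M\<^sub>2\<close>. It suffices that \<open>h\<close> stays above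
  \<open>h(0) / 2\<close> on an interval of length of order \<open>min (1 / sqrt (ln (e / M\<^sub>1))) (M\<^sub>1 / \<bar>M\<^sub>2\<bar>)\<close>.

  For positive \<open>u\<close>, \<open>v\<close> with barycentres \<open>b(u)\<close>, \<open>b(v)\<close> (the vectors of \<open>\<E>[\<partial>\<^sub>k u] / \<E> u\<close>) one has
  \<open>\<E>[u T\<^sub>\<rho> v] \<ge> \<E> u \<E> v exp(\<rho> \<langle>b(u), b(v)\<rangle> - C \<rho>\<^sup>2 (R(u) + R(v)))\<close>, up to higher-order factors, where
  \<open>R(u) = ln (\<E> u\<^sup>2 / (\<E> u)\<^sup>2)\<close>. This is an induction on the dimension: conditionally on the past,
  one couples the next coordinates of the laws with densities \<open>u\<close> and \<open>v\<close>, giving them a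
  correlation close to \<open>\<rho>\<close>, and applies Jensen's inequality.

  The inequality is applied to the smoothed derivatives \<open>u = T\<^sub>1\<^sub>/\<^sub>2 \<partial>\<^sub>i f\<close>, \<open>v = T\<^sub>1\<^sub>/\<^sub>2 \<partial>\<^sub>i g\<close> and summed over
  \<open>i\<close>. Since their second moments have a bounded sum over \<open>i\<close>, concavity of the logarithm
  bounds the total error by a multiple of \<open>\<rho>\<^sup>2 M\<^sub>1 ln (e / M\<^sub>1)\<close>.
\<close>

section \<open>Splitting the cube along its last coordinate\<close>

definition slice :: "nat \<Rightarrow> real \<Rightarrow> ((nat \<Rightarrow> real) \<Rightarrow> real) \<Rightarrow> (nat \<Rightarrow> real) \<Rightarrow> real" where
  "slice n s u = (\<lambda>x. u (x(Suc n := s)))"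

lemma slice_deriv:
  assumes "k \<le> n"
  shows "slice n s (discrete_deriv k u) = discrete_deriv k (slice n s u)"
  using assms by (auto simp: slice_def discrete_deriv_def fun_eq_iff fun_upd_twist)

lemma slice_deriv_last:
  "slice n s (discrete_deriv (Suc n) u) = (\<lambda>x. 1/2 * slice n 1 u x + (-1/2) * slice n (-1) u x)"
  by (auto simp: slice_def discrete_deriv_def fun_eq_iff field_simps)

lemma cube_Suc: "cube (Suc n) = (\<lambda>x. x(Suc n := 1)) ` cube n \<union> (\<lambda>x. x(Suc n := -1)) ` cube n"
proof -
  have "{1..Suc n} = insert (Suc n) {1..n}" by auto
  then show ?thesis
    by (auto simp: cube_def PiE_insert_eq image_iff)
qed

lemma inj_on_upd_cube: "inj_on (\<lambda>x. x(Suc n := s)) (cube n)"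
proof (rule inj_onI)
  fix x y assume "x \<in> cube n" "y \<in> cube n" and eq: "x(Suc n := s) = y(Suc n := s)"
  then have "x (Suc n) = y (Suc n)"
    by (simp add: cube_def PiE_iff extensional_def)
  with eq show "x = y"
    by (metis fun_upd_triv fun_upd_upd)
qed

lemma upd_cube_Suc: "x \<in> cube n \<Longrightarrow> s = 1 \<or> s = -1 \<Longrightarrow> x(Suc n := s) \<in> cube (Suc n)"
  by (auto simp: cube_Suc)

lemma cube_exp_0: "cube_exp 0 u = u (\<lambda>_. undefined)"
  by (simp add: cube_exp_eq_sum cube_def)

lemma cube_exp_Suc: "cube_exp (Suc n) u = (cube_exp n (slice n 1 u) + cube_exp n (slice n (-1) u)) / 2"
proof -
  have disj: "(\<lambda>x. x(Suc n := 1)) ` cube n \<inter> (\<lambda>x. x(Suc n := -1::real)) ` cube n = {}"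
    by (auto dest: fun_cong[where x = "Suc n"])
  show ?thesis
    unfolding cube_exp_eq_sum cube_Suc
    by (subst sum.union_disjoint)
      (auto simp: disj finite_cube sum.reindex[OF inj_on_upd_cube] slice_def field_simps)
qed

lemma cube_exp_linear:
  "cube_exp n (\<lambda>x. a * u x + b * w x) = a * cube_exp n u + b * cube_exp n w"
  by (simp add: cube_exp_eq_sum sum.distrib sum_distrib_left add_divide_distrib)

lemma cube_exp_cong: "(\<And>x. x \<in> cube n \<Longrightarrow> u x = v x) \<Longrightarrow> cube_exp n u = cube_exp n v"
  by (simp add: cube_exp_eq_sum cong: sum.cong)

lemma cube_exp_nonneg: "(\<And>x. x \<in> cube n \<Longrightarrow> 0 \<le> u x) \<Longrightarrow> 0 \<le> cube_exp n u"
  by (simp add: cube_exp_eq_sum sum_nonneg)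

lemma cube_exp_pos: "(\<And>x. x \<in> cube n \<Longrightarrow> 0 < u x) \<Longrightarrow> 0 < cube_exp n u"
  by (simp add: cube_exp_eq_sum sum_pos finite_cube cube_nonempty)

lemma cube_exp_eq_0_imp:
  assumes "\<And>x. x \<in> cube n \<Longrightarrow> 0 \<le> u x" "cube_exp n u = 0" "x \<in> cube n"
  shows "u x = 0"
  using assms by (simp add: cube_exp_eq_sum sum_nonneg_eq_0_iff finite_cube)

text \<open>An arbitrary predicate lets nonnegativity and strict positivity pass to slices by one
  rule.\<close>

lemma slice_cube:
  assumes "\<And>x. x \<in> cube (Suc n) \<Longrightarrow> P (u x)" "x \<in> cube n" "s = 1 \<or> s = -1"
  shows "P (slice n s u x)"
  using assms by (auto simp: slice_def upd_cube_Suc)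

lemma cube_exp_deriv_Suc:
  assumes "k \<le> n"
  shows "cube_exp (Suc n) (discrete_deriv k u) =
    (cube_exp n (discrete_deriv k (slice n 1 u)) + cube_exp n (discrete_deriv k (slice n (-1) u))) / 2"
  using assms by (simp add: cube_exp_Suc slice_deriv)

lemma cube_exp_deriv_last:
  "cube_exp (Suc n) (discrete_deriv (Suc n) u) =
    (cube_exp n (slice n 1 u) - cube_exp n (slice n (-1) u)) / 2"
  unfolding cube_exp_Suc slice_deriv_last cube_exp_linear by simp

section \<open>The noise form and its derivative in the correlation parameter\<close>

text \<open>This is \<open>\<rho>\<mapsto>\<E>[u T\<^sub>\<rho> v]\<close> with the noise operator \<open>T\<^sub>\<rho>\<close>, that is
  the expectation of \<open>u(x) v(y)\<close> over \<open>\<rho>\<close>-correlated points \<open>x\<close>, \<open>y\<close> of the cube.\<close>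

primrec noise_form ::
  "real \<Rightarrow> nat \<Rightarrow> ((nat \<Rightarrow> real) \<Rightarrow> real) \<Rightarrow> ((nat \<Rightarrow> real) \<Rightarrow> real) \<Rightarrow> real" where
  "noise_form \<rho> 0 u v = u (\<lambda>_. undefined) * v (\<lambda>_. undefined)"
| "noise_form \<rho> (Suc n) u v =
    ((1 + \<rho>) * (noise_form \<rho> n (slice n 1 u) (slice n 1 v)
              + noise_form \<rho> n (slice n (-1) u) (slice n (-1) v))
   + (1 - \<rho>) * (noise_form \<rho> n (slice n 1 u) (slice n (-1) v)
              + noise_form \<rho> n (slice n (-1) u) (slice n 1 v))) / 4"

lemma slice_linear:
  "slice n s (\<lambda>x. a * u x + b * w x) = (\<lambda>x. a * slice n s u x + b * slice n s w x)"
  by (simp add: slice_def)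

lemma noise_form_linear_left:
  "noise_form \<rho> n (\<lambda>x. a * u x + b * w x) v = a * noise_form \<rho> n u v + b * noise_form \<rho> n w v"
proof (induction n arbitrary: u w v)
  case 0 then show ?case by (simp add: algebra_simps)
next
  case (Suc n) show ?case
    by (simp add: slice_linear Suc.IH, simp add: field_simps)
qed

lemma noise_form_commute: "noise_form \<rho> n u v = noise_form \<rho> n v u"
  by (induction n arbitrary: u v) simp_all

lemma noise_form_linear_right:
  "noise_form \<rho> n v (\<lambda>x. a * u x + b * w x) = a * noise_form \<rho> n v u + b * noise_form \<rho> n v w"
  by (metis noise_form_commute noise_form_linear_left)

text \<open>With \<open>noise_form_0\<close> this makes \<open>Cor n f g\<close> the increment of
  the noise form between correlations 0 and 1.\<close>

lemma noise_form_1: "noise_form 1 n u v = cube_exp n (\<lambda>x. u x * v x)"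
proof (induction n arbitrary: u v)
  case 0 then show ?case by (simp add: cube_exp_0)
next
  case (Suc n)
  have "slice n s (\<lambda>x. u x * v x) = (\<lambda>x. slice n s u x * slice n s v x)" for s
    by (simp add: slice_def)
  then show ?case by (simp add: cube_exp_Suc Suc.IH)
qed

lemma noise_form_0: "noise_form 0 n u v = cube_exp n u * cube_exp n v"
  by (induction n arbitrary: u v) (simp_all add: cube_exp_0 cube_exp_Suc field_simps)

lemma noise_form_nonneg:
  assumes "\<bar>\<rho>\<bar> \<le> 1" "\<And>x. x \<in> cube n \<Longrightarrow> 0 \<le> u x" "\<And>x. x \<in> cube n \<Longrightarrow> 0 \<le> v x"
  shows "0 \<le> noise_form \<rho> n u v"
  using assms(2,3)
proof (induction n arbitrary: u v)
  case 0 then show ?case by (simp add: cube_def)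
next
  case (Suc n)
  have "0 \<le> noise_form \<rho> n (slice n s u) (slice n t v)" if "s = 1 \<or> s = -1" "t = 1 \<or> t = -1" for s t
    using that by (intro Suc.IH) (blast intro: slice_cube Suc.prems)+
  then show ?case using assms(1) by (auto intro!: add_nonneg_nonneg)
qed

text \<open>Product rule in the recursion: differentiating the weights \<open>1 + \<rho>\<close> and
  \<open>1 - \<rho>\<close> produces the summand of the last coordinate, and differentiating the
  lower-dimensional forms produces the others.\<close>

lemma noise_form_deriv:
  "((\<lambda>\<rho>. noise_form \<rho> n u v) has_real_derivative
     (\<Sum>i=1..n. noise_form \<rho> n (discrete_deriv i u) (discrete_deriv i v))) (at \<rho>)"
proof (induction n arbitrary: u v)
  case 0 then show ?case by simp
next
  case (Suc n)
  have eq: "(\<Sum>i=1..Suc n. noise_form \<rho> (Suc n) (discrete_deriv i u) (discrete_deriv i v)) =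
     ((1 + \<rho>) * ((\<Sum>i=1..n. noise_form \<rho> n (discrete_deriv i (slice n 1 u)) (discrete_deriv i (slice n 1 v)))
              + (\<Sum>i=1..n. noise_form \<rho> n (discrete_deriv i (slice n (-1) u)) (discrete_deriv i (slice n (-1) v))))
   + (1 - \<rho>) * ((\<Sum>i=1..n. noise_form \<rho> n (discrete_deriv i (slice n 1 u)) (discrete_deriv i (slice n (-1) v)))
              + (\<Sum>i=1..n. noise_form \<rho> n (discrete_deriv i (slice n (-1) u)) (discrete_deriv i (slice n 1 v))))) / 4
   + (noise_form \<rho> n (slice n 1 u) (slice n 1 v)
              + noise_form \<rho> n (slice n (-1) u) (slice n (-1) v)
      - noise_form \<rho> n (slice n 1 u) (slice n (-1) v)
              - noise_form \<rho> n (slice n (-1) u) (slice n 1 v)) / 4"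
  proof -
    have low: "noise_form \<rho> (Suc n) (discrete_deriv i u) (discrete_deriv i v) =
       ((1 + \<rho>) * (noise_form \<rho> n (discrete_deriv i (slice n 1 u)) (discrete_deriv i (slice n 1 v))
                + noise_form \<rho> n (discrete_deriv i (slice n (-1) u)) (discrete_deriv i (slice n (-1) v)))
     + (1 - \<rho>) * (noise_form \<rho> n (discrete_deriv i (slice n 1 u)) (discrete_deriv i (slice n (-1) v))
                + noise_form \<rho> n (discrete_deriv i (slice n (-1) u)) (discrete_deriv i (slice n 1 v)))) / 4"
      if "i \<in> {1..n}" for i
      using that by (simp add: slice_deriv)
    \<comment> \<open>Both slices of the derivative in the last coordinate coincide, so the weights
      add up to 1 and the explicit factors in \<open>\<rho>\<close> disappear.\<close>
    have last: "noise_form \<rho> (Suc n) (discrete_deriv (Suc n) u) (discrete_deriv (Suc n) v) =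
       (noise_form \<rho> n (slice n 1 u) (slice n 1 v)
              + noise_form \<rho> n (slice n (-1) u) (slice n (-1) v)
      - noise_form \<rho> n (slice n 1 u) (slice n (-1) v)
              - noise_form \<rho> n (slice n (-1) u) (slice n 1 v)) / 4"
      unfolding noise_form.simps slice_deriv_last noise_form_linear_left noise_form_linear_right
      by (simp add: field_simps)
    show ?thesis
      unfolding sum_distrib_left sum.distrib[symmetric] sum_divide_distrib
      by (simp add: low last del: noise_form.simps)
  qed
  have rule: "((\<lambda>r. ((1 + r) * (P r + Q r) + (1 - r) * (R r + S r)) / 4) has_real_derivative
      ((1 + \<rho>) * (P' + Q') + (1 - \<rho>) * (R' + S')) / 4 + (P \<rho> + Q \<rho> - R \<rho> - S \<rho>) / 4) (at \<rho>)"
    if "(P has_real_derivative P') (at \<rho>)" "(Q has_real_derivative Q') (at \<rho>)"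
      "(R has_real_derivative R') (at \<rho>)" "(S has_real_derivative S') (at \<rho>)" for P Q R S P' Q' R' S'
    by (rule derivative_eq_intros that refl | simp)+ (simp add: field_simps)
  show ?case unfolding eq unfolding noise_form.simps by (intro rule Suc.IH)
qed

section \<open>The noise operator\<close>

text \<open>Each coordinate is resampled independently with conditional mean \<open>a * x k\<close>.
  The point \<open>x\<close> enters only through these weights, so it need not be changed when
  passing to slices.\<close>

primrec noise_op :: "real \<Rightarrow> nat \<Rightarrow> ((nat \<Rightarrow> real) \<Rightarrow> real) \<Rightarrow> (nat \<Rightarrow> real) \<Rightarrow> real" where
  "noise_op a 0 u x = u (\<lambda>_. undefined)"
| "noise_op a (Suc n) u x =
    ((1 + a * x (Suc n)) * noise_op a n (slice n 1 u) x
   + (1 - a * x (Suc n)) * noise_op a n (slice n (-1) u) x) / 2"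

lemma noise_op_upd: "n < k \<Longrightarrow> noise_op a n u (x(k := s)) = noise_op a n u x"
  by (induction n arbitrary: u) auto

lemma slice_noise_op:
  "slice n s (noise_op a (Suc n) u) =
    (\<lambda>x. (1 + a * s) / 2 * noise_op a n (slice n 1 u) x + (1 - a * s) / 2 * noise_op a n (slice n (-1) u) x)"
  by (simp add: slice_def noise_op_upd fun_eq_iff field_simps)

text \<open>Self-adjointness and the semigroup law: noise \<open>a\<close>, then
  \<open>\<rho>\<close>, then \<open>a\<close> is noise \<open>\<rho> * a\<^sup>2\<close>.\<close>

lemma noise_form_noise_op:
  "noise_form \<rho> n (noise_op a n u) (noise_op a n v) = noise_form (\<rho> * a\<^sup>2) n u v"
proof (induction n arbitrary: u v)
  case 0 then show ?case by simp
next
  case (Suc n)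
  show ?case
    unfolding noise_form.simps slice_noise_op noise_form_linear_left noise_form_linear_right Suc.IH
    by (simp add: field_simps power2_eq_square)
qed

lemma cube_exp_noise_op: "cube_exp n (noise_op a n u) = cube_exp n u"
proof (induction n arbitrary: u)
  case 0 then show ?case by (simp add: cube_exp_0)
next
  case (Suc n) show ?case
    unfolding cube_exp_Suc slice_noise_op cube_exp_linear Suc.IH by (simp add: field_simps)
qed

lemma discrete_deriv_linear:
  "discrete_deriv k (\<lambda>x. a * u x + b * w x) = (\<lambda>x. a * discrete_deriv k u x + b * discrete_deriv k w x)"
  by (simp add: discrete_deriv_def fun_eq_iff field_simps)

text \<open>These are the Fourier coefficients of degree one, which noise multiplies by
  \<open>a\<close>.\<close>

lemma cube_exp_deriv_noise_op:
  "k \<in> {1..n} \<Longrightarrow>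
    cube_exp n (discrete_deriv k (noise_op a n u)) = a * cube_exp n (discrete_deriv k u)"
proof (induction n arbitrary: u)
  case 0 then show ?case by simp
next
  case (Suc n)
  show ?case
  proof (cases "k = Suc n")
    case True
    show ?thesis
      unfolding True cube_exp_deriv_last slice_noise_op cube_exp_linear cube_exp_noise_op
      by (simp add: field_simps)
  next
    case False
    with Suc.prems have "k \<le> n" "k \<in> {1..n}" by auto
    then show ?thesis
      unfolding cube_exp_deriv_Suc[OF \<open>k \<le> n\<close>] slice_noise_op discrete_deriv_linear cube_exp_linear
      by (simp add: Suc.IH field_simps)
  qed
qed

text \<open>Every transition probability is at least \<open>(1 - a) ^ n\<close> times the uniform
  one. For \<open>a = 1/2\<close> this makes smoothed functions strictly positive, so that
  logarithms can be taken. The domain of \<open>x\<close> is not \<open>cube n\<close>, because the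
  induction keeps the same \<open>x\<close> in lower dimensions.\<close>

lemma noise_op_ge:
  assumes "0 \<le> a" "a \<le> 1" "\<And>x. x \<in> cube n \<Longrightarrow> 0 \<le> u x" "x \<in> {1..n} \<rightarrow> {-1, 1}"
  shows "(1 - a) ^ n * cube_exp n u \<le> noise_op a n u x"
  using assms(3,4)
proof (induction n arbitrary: u)
  case 0 then show ?case by (simp add: cube_exp_0)
next
  case (Suc n)
  define P where "P s = (1 - a) ^ n * cube_exp n (slice n s u)" for s
  have nonneg: "0 \<le> P s" if "s = 1 \<or> s = -1" for s
    unfolding P_def using that assms(2)
    by (intro mult_nonneg_nonneg cube_exp_nonneg) (auto intro: slice_cube Suc.prems)
  have IH: "P s \<le> noise_op a n (slice n s u) x" if "s = 1 \<or> s = -1" for s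
    unfolding P_def using that Suc.prems(2)
    by (intro Suc.IH) (auto intro: slice_cube Suc.prems(1))
  have "x (Suc n) \<in> {-1, 1}" using Suc.prems(2) by auto
  then have c: "1 - a \<le> 1 + a * x (Suc n)" "1 - a \<le> 1 - a * x (Suc n)"
    using assms(1) by auto
  have "(1 - a) * P 1 \<le> (1 + a * x (Suc n)) * noise_op a n (slice n 1 u) x"
    using c nonneg[of 1] IH[of 1] assms(2) by (intro mult_mono) auto
  moreover have "(1 - a) * P (-1) \<le> (1 - a * x (Suc n)) * noise_op a n (slice n (-1) u) x"
    using c nonneg[of "-1"] IH[of "-1"] assms(2) by (intro mult_mono) auto
  ultimately show ?case
    by (simp add: cube_exp_Suc P_def algebra_simps add_divide_distrib)
qed

text \<open>By the semigroup law this is the second moment of \<open>u\<close> smoothed with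
  parameter \<open>sqrt \<rho>\<close>.\<close>

lemma noise_form_diag_nonneg:
  assumes "0 \<le> \<rho>" shows "0 \<le> noise_form \<rho> n u u"
proof -
  have "noise_form \<rho> n u u = noise_form 1 n (noise_op (sqrt \<rho>) n u) (noise_op (sqrt \<rho>) n u)"
    using assms by (simp add: noise_form_noise_op)
  also have "\<dots> \<ge> 0"
    by (simp add: noise_form_1 cube_exp_nonneg)
  finally show ?thesis .
qed

section \<open>Jensen's inequality and the coupling of two biased signs\<close>

lemma jensen_ln:
  fixes w X :: "'a \<Rightarrow> real"
  assumes "finite I" "\<And>i. i \<in> I \<Longrightarrow> 0 < w i" "\<And>i. i \<in> I \<Longrightarrow> 0 < X i" "sum w I = 1"
  shows "(\<Sum>i\<in>I. w i * ln (X i)) \<le> ln (\<Sum>i\<in>I. w i * X i)"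
proof -
  define Z where "Z = (\<Sum>i\<in>I. w i * X i)"
  have "I \<noteq> {}" using assms(4) by auto
  then have Z: "0 < Z" unfolding Z_def using assms by (intro sum_pos) auto
  have "w i * ln (X i) \<le> w i * (ln Z + X i / Z - 1)" if "i \<in> I" for i
  proof -
    have "ln (X i / Z) \<le> X i / Z - 1"
      using Z assms(3)[OF that] by (intro ln_le_minus_one) auto
    then have "ln (X i) \<le> ln Z + X i / Z - 1"
      using Z assms(3)[OF that] by (simp add: ln_div)
    then show ?thesis using assms(2)[OF that] by (intro mult_left_mono) auto
  qed
  then have "(\<Sum>i\<in>I. w i * ln (X i)) \<le> (\<Sum>i\<in>I. w i * (ln Z + X i / Z - 1))"
    by (rule sum_mono)
  also have "\<dots> = (ln Z - 1) * sum w I + (\<Sum>i\<in>I. w i * X i) / Z"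
    unfolding sum_distrib_left sum_divide_distrib sum.distrib[symmetric]
    by (intro sum.cong) (auto simp: algebra_simps)
  also have "\<dots> = ln Z" using Z assms(4) by (simp flip: Z_def)
  finally show ?thesis unfolding Z_def .
qed

text \<open>The law of a pair of signs with means \<open>a\<close> and \<open>b\<close> and covariance \<open>\<rho> (1 - a\<^sup>2) (1 - b\<^sup>2)\<close>.\<close>

definition corr_weight :: "real \<Rightarrow> real \<Rightarrow> real \<Rightarrow> real \<Rightarrow> real \<Rightarrow> real" where
  "corr_weight \<rho> a b s t = (1 + s * a) * (1 + t * b) * (1 + \<rho> * (s - a) * (t - b)) / 4"

text \<open>Both differences have absolute value below 2, which is where the restriction
  \<open>\<rho> \<le> 1/4\<close> comes from.\<close>

lemma corr_factor_pos:
  fixes \<rho> a b s t :: real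
  assumes "0 \<le> \<rho>" "\<rho> \<le> 1/4" "\<bar>a\<bar> < 1" "\<bar>b\<bar> < 1" "s = 1 \<or> s = -1" "t = 1 \<or> t = -1"
  shows "0 < 1 + \<rho> * (s - a) * (t - b)"
proof -
  have "\<bar>s - a\<bar> < 2" "\<bar>t - b\<bar> < 2" using assms(3-6) by auto
  then have "\<bar>s - a\<bar> * \<bar>t - b\<bar> < 2 * 2" by (intro mult_strict_mono) auto
  moreover have "\<rho> * (\<bar>s - a\<bar> * \<bar>t - b\<bar>) \<le> 1/4 * (\<bar>s - a\<bar> * \<bar>t - b\<bar>)"
    using assms by (intro mult_right_mono) auto
  ultimately have "\<bar>\<rho> * (s - a) * (t - b)\<bar> < 1"
    using assms(1) by (simp add: abs_mult mult.assoc)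
  then show ?thesis by linarith
qed

lemma corr_weight_pos:
  assumes "0 \<le> \<rho>" "\<rho> \<le> 1/4" "\<bar>a\<bar> < 1" "\<bar>b\<bar> < 1" "s = 1 \<or> s = -1" "t = 1 \<or> t = -1"
  shows "0 < corr_weight \<rho> a b s t"
  using corr_factor_pos[OF assms] assms unfolding corr_weight_def
  by (intro divide_pos_pos mult_pos_pos) auto

lemma corr_weight_marginals:
  "corr_weight \<rho> a b s 1 + corr_weight \<rho> a b s (-1) = (1 + s * a) / 2"
  "corr_weight \<rho> a b 1 t + corr_weight \<rho> a b (-1) t = (1 + t * b) / 2"
  by (simp_all add: corr_weight_def field_simps)

lemma corr_weight_cross:
  "corr_weight \<rho> a b 1 1 - corr_weight \<rho> a b 1 (-1) - corr_weight \<rho> a b (-1) 1 + corr_weight \<rho> a b (-1) (-1)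
    = a * b + \<rho> * (1 - a\<^sup>2) * (1 - b\<^sup>2)"
  by (simp add: corr_weight_def field_simps power2_eq_square)

text \<open>The first-order term \<open>\<rho>ab\<close> is exact here, and the error vanishes at \<open>a = b = 0\<close>;
  a product coupling would lose \<open>\<rho>\<^sup>2\<close> in every coordinate.\<close>

lemma corr_weight_cost:
  assumes "0 \<le> \<rho>" "\<rho> \<le> 1/4" "\<bar>a\<bar> < 1" "\<bar>b\<bar> < 1"
  shows "\<rho> / (1 - \<rho>\<^sup>2) * (a * b - 3/2 * \<rho> * (a\<^sup>2 + b\<^sup>2)) \<le>
    (\<Sum>s\<in>{1,-1}. \<Sum>t\<in>{1,-1}. corr_weight \<rho> a b s t * (1 - (1 + \<rho> * (s - a) * (t - b)) / (1 + \<rho> * s * t)))"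
proof -
  define w where "w = corr_weight \<rho> a b"
  define e where "e = w 1 1 - w 1 (-1) - w (-1) 1 + w (-1) (-1)"
  have pos: "0 < w s t" if "s = 1 \<or> s = -1" "t = 1 \<or> t = -1" for s t
    unfolding w_def using corr_weight_pos[OF assms that] .
  have marg: "w 1 (-1) = (1 + a) / 2 - w 1 1" "w (-1) 1 = (1 + b) / 2 - w 1 1"
    "w (-1) (-1) = (1 - a) / 2 - (1 + b) / 2 + w 1 1"
    using corr_weight_marginals(1)[of \<rho> a b 1] corr_weight_marginals(1)[of \<rho> a b "-1"]
      corr_weight_marginals(2)[of \<rho> a b 1] unfolding w_def by (simp_all add: field_simps)
  have \<rho>2: "0 < 1 - \<rho>\<^sup>2"
    using assms power_mono[of \<rho> "1/4" 2] by (simp add: power2_eq_square)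
  \<comment> \<open>Since \<open>s * t\<close> is a sign, the reciprocal of
    \<open>1 + \<rho> * s * t\<close> is \<open>(1 - \<rho> * s * t) / (1 - \<rho>\<^sup>2)\<close>.
    The cost becomes a polynomial in the signs, with the prefactor called \<open>r\<close>
    later.\<close>
  have summand: "w s t * (1 - (1 + \<rho> * (s - a) * (t - b)) / (1 + \<rho> * s * t)) =
      \<rho> / (1 - \<rho>\<^sup>2) * (w s t * ((b * s + a * t - a * b) * (1 - \<rho> * s * t)))"
    if "s = 1 \<or> s = -1" "t = 1 \<or> t = -1" for s t
  proof -
    have "s * t = 1 \<or> s * t = -1" using that by auto
    then have nz: "1 + \<rho> * s * t \<noteq> 0" using assms by (auto simp: mult.assoc)
    have "(1 + \<rho> * s * t) * (1 - \<rho> * s * t) = 1 - \<rho>\<^sup>2"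
      using that by (auto simp: power2_eq_square algebra_simps)
    then have "1 / (1 + \<rho> * s * t) = (1 - \<rho> * s * t) / (1 - \<rho>\<^sup>2)"
      using nz \<rho>2 by (simp add: frac_eq_eq mult.commute)
    moreover have "1 - (1 + \<rho> * (s - a) * (t - b)) / (1 + \<rho> * s * t) =
        \<rho> * (b * s + a * t - a * b) * (1 / (1 + \<rho> * s * t))"
      using nz by (simp add: field_simps)
    ultimately show ?thesis by simp
  qed
  \<comment> \<open>\<open>e\<close> is the mean of the product of the coupled signs. Bounding
    \<open>a * b * e\<close> by AM-GM then raises the coefficient of the squares from 1 to
    3/2.\<close>
  have "\<bar>e\<bar> \<le> 1"
    unfolding e_def abs_le_iff using pos[of 1 1] pos[of 1 "-1"] pos[of "-1" 1] pos[of "-1" "-1"] marg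
    by (simp add: field_simps)
  have ab: "\<bar>a * b\<bar> \<le> (a\<^sup>2 + b\<^sup>2) / 2"
    using sum_squares_bound[of "\<bar>a\<bar>" "\<bar>b\<bar>"] by (simp add: abs_mult)
  have "\<bar>a * b * e\<bar> \<le> \<bar>a * b\<bar> * 1"
    unfolding abs_mult[of "a * b" e] using \<open>\<bar>e\<bar> \<le> 1\<close> by (intro mult_left_mono) auto
  then have abe: "- (a\<^sup>2 + b\<^sup>2) / 2 \<le> a * b * e" using ab by linarith
  have e_eq: "e = a * b + \<rho> * (1 - a\<^sup>2) * (1 - b\<^sup>2)"
    unfolding e_def w_def by (rule corr_weight_cross)
  have "(\<Sum>s\<in>{1,-1}. \<Sum>t\<in>{1,-1}. w s t * ((b * s + a * t - a * b) * (1 - \<rho> * s * t))) =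
      a * b - \<rho> * (a\<^sup>2 + b\<^sup>2) + \<rho> * (a * b * e)"
    unfolding e_def by simp (simp add: marg field_simps power2_eq_square)
  moreover have "\<rho> * (- (a\<^sup>2 + b\<^sup>2) / 2) \<le> \<rho> * (a * b * e)"
    by (intro mult_left_mono abe assms)
  ultimately have "a * b - 3/2 * \<rho> * (a\<^sup>2 + b\<^sup>2) \<le>
      (\<Sum>s\<in>{1,-1}. \<Sum>t\<in>{1,-1}. w s t * ((b * s + a * t - a * b) * (1 - \<rho> * s * t)))"
    by (simp only:)
  then have "\<rho> / (1 - \<rho>\<^sup>2) * (a * b - 3/2 * \<rho> * (a\<^sup>2 + b\<^sup>2)) \<le> \<rho> / (1 - \<rho>\<^sup>2) *
      (\<Sum>s\<in>{1,-1}. \<Sum>t\<in>{1,-1}. w s t * ((b * s + a * t - a * b) * (1 - \<rho> * s * t)))"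
    using \<rho>2 assms by (intro mult_left_mono) auto
  also have "\<dots> = (\<Sum>s\<in>{1,-1}. \<Sum>t\<in>{1,-1}. w s t * (1 - (1 + \<rho> * (s - a) * (t - b)) / (1 + \<rho> * s * t)))"
    unfolding sum_distrib_left by (intro sum.cong refl) (auto simp: summand)
  finally show ?thesis unfolding w_def .
qed

text \<open>Under the coupling, \<open>X\<close> and \<open>Y\<close> have covariance
  \<open>\<rho> * (A * x * (B * y))\<close> and variances \<open>A * x\<^sup>2\<close> and
  \<open>B * y\<^sup>2\<close>. As \<open>A\<close> and \<open>B\<close> are at most 1, AM-GM bounds
  the covariance below by \<open>-\<rho> / 2\<close> times the sum of the variances.\<close>

lemma corr_weight_product:
  fixes X Y :: "real \<Rightarrow> real"
  assumes "0 \<le> \<rho>" "\<bar>a\<bar> < 1" "\<bar>b\<bar> < 1"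
  defines "p \<equiv> \<lambda>F. (1 + a) / 2 * F 1 + (1 - a) / 2 * F (-1)"
    and "q \<equiv> \<lambda>F. (1 + b) / 2 * F 1 + (1 - b) / 2 * F (-1 :: real)"
  shows "p X * q Y - \<rho> / 2 * (p (\<lambda>s. (X s)\<^sup>2) - (p X)\<^sup>2 + (q (\<lambda>s. (Y s)\<^sup>2) - (q Y)\<^sup>2)) \<le>
    (\<Sum>s\<in>{1,-1}. \<Sum>t\<in>{1,-1}. corr_weight \<rho> a b s t * (X s * Y t))"
proof -
  define x y where "x = (X 1 - X (-1)) / 2" and "y = (Y 1 - Y (-1)) / 2"
  define A B where "A = 1 - a\<^sup>2" and "B = 1 - b\<^sup>2"
  have AB: "0 \<le> A" "A \<le> 1" "0 \<le> B" "B \<le> 1"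
    using assms by (auto simp: A_def B_def abs_square_le_1)
  have "(\<Sum>s\<in>{1,-1}. \<Sum>t\<in>{1,-1}. corr_weight \<rho> a b s t * (X s * Y t)) = p X * q Y + \<rho> * (A * x * (B * y))"
    by (simp add: corr_weight_def p_def q_def x_def y_def A_def B_def field_simps power2_eq_square)
  moreover have "p (\<lambda>s. (X s)\<^sup>2) - (p X)\<^sup>2 = A * x\<^sup>2" "q (\<lambda>s. (Y s)\<^sup>2) - (q Y)\<^sup>2 = B * y\<^sup>2"
    by (simp_all add: p_def q_def x_def y_def A_def B_def field_simps power2_eq_square)
  moreover have "- (A * x * (B * y)) \<le> (A * x\<^sup>2 + B * y\<^sup>2) / 2"
  proof -
    have "0 \<le> (A * x + B * y)\<^sup>2" by simp
    then have "- (A * x * (B * y)) \<le> (A * A * x\<^sup>2 + B * B * y\<^sup>2) / 2"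
      by (simp add: power2_eq_square algebra_simps)
    also have "\<dots> \<le> (1 * A * x\<^sup>2 + 1 * B * y\<^sup>2) / 2"
      using AB by (intro divide_right_mono add_mono mult_right_mono) auto
    finally show ?thesis by simp
  qed
  then have "\<rho> * - (A * x * (B * y)) \<le> \<rho> * ((A * x\<^sup>2 + B * y\<^sup>2) / 2)"
    by (intro mult_left_mono assms)
  ultimately show ?thesis by (simp only:)
qed

text \<open>Applying \<open>ln z \<le> z - 1\<close> to the reciprocal of \<open>sqrt y\<close>
  gives \<open>y / 2 * ln y \<ge> y - sqrt y\<close>. With \<open>y = 1 + a\<close> and
  \<open>y = 1 - a\<close> it remains to bound a sum of two square roots by
  \<open>2 - a\<^sup>2 / 4\<close>.\<close>

lemma binary_entropy_ge:
  fixes a :: real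
  assumes "\<bar>a\<bar> < 1"
  shows "a\<^sup>2 / 4 \<le> (1 + a) / 2 * ln (1 + a) + (1 - a) / 2 * ln (1 - a)"
proof -
  have *: "(y - sqrt y) \<le> y / 2 * ln y" if "0 < y" for y :: real
  proof -
    have "ln (1 / sqrt y) \<le> 1 / sqrt y - 1" using that by (intro ln_le_minus_one) auto
    then have "2 * (1 - 1 / sqrt y) \<le> ln y" using that by (simp add: ln_div ln_sqrt)
    then have "y / 2 * (2 * (1 - 1 / sqrt y)) \<le> y / 2 * ln y"
      using that by (intro mult_left_mono) auto
    moreover have "y / sqrt y = sqrt y" using that by (simp add: real_div_sqrt)
    ultimately show ?thesis by (simp add: algebra_simps)
  qed
  have "sqrt (1 + a) + sqrt (1 - a) \<le> 2 - a\<^sup>2 / 4"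
  proof (rule power2_le_imp_le)
    have a2: "a\<^sup>2 \<le> 1" using assms by (simp add: abs_square_le_1)
    have "sqrt (1 + a) * sqrt (1 - a) = sqrt (1 - a\<^sup>2)"
      by (simp add: power2_eq_square algebra_simps flip: real_sqrt_mult)
    also have "\<dots> \<le> 1 - a\<^sup>2 / 2"
    proof (rule real_le_lsqrt)
      have "(1 - a\<^sup>2 / 2)\<^sup>2 = 1 - a\<^sup>2 + (a\<^sup>2)\<^sup>2 / 4"
        by (simp add: power2_diff power_divide)
      then show "1 - a\<^sup>2 \<le> (1 - a\<^sup>2 / 2)\<^sup>2" by simp
    qed (use a2 in simp)
    finally have "(sqrt (1 + a) + sqrt (1 - a))\<^sup>2 \<le> 2 + 2 * (1 - a\<^sup>2 / 2)"
      using assms by (simp add: power2_sum)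
    also have "\<dots> \<le> (2 - a\<^sup>2 / 4)\<^sup>2"
      by (simp add: power2_diff)
    finally show "(sqrt (1 + a) + sqrt (1 - a))\<^sup>2 \<le> (2 - a\<^sup>2 / 4)\<^sup>2" .
    show "0 \<le> 2 - a\<^sup>2 / 4" using a2 by simp
  qed
  then show ?thesis using *[of "1 + a"] *[of "1 - a"] assms by linarith
qed


section \<open>Barycentres, Renyi divergence and the logarithmic bound for the noise form\<close>

text \<open>For positive \<open>u\<close>, the mean of the \<open>k\<close>-th sign under the law
  with density proportional to \<open>u\<close>.\<close>

definition bias :: "nat \<Rightarrow> ((nat \<Rightarrow> real) \<Rightarrow> real) \<Rightarrow> nat \<Rightarrow> real" where
  "bias n u k = cube_exp n (discrete_deriv k u) / cube_exp n u"

text \<open>The order-2 Renyi divergence of that law from the uniform measure.\<close>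

definition renyi :: "nat \<Rightarrow> ((nat \<Rightarrow> real) \<Rightarrow> real) \<Rightarrow> real" where
  "renyi n u = ln (cube_exp n (\<lambda>x. (u x)\<^sup>2) / (cube_exp n u)\<^sup>2)"

text \<open>The last sign has mean \<open>a\<close>, so its values have probabilities
  \<open>(1 + a) / 2\<close> and \<open>(1 - a) / 2\<close>, and the earlier biases are averages of
  the conditional ones.\<close>

lemma bias_Suc:
  assumes pos: "0 < cube_exp n (slice n 1 u)" "0 < cube_exp n (slice n (-1) u)"
  defines "a \<equiv> bias (Suc n) u (Suc n)"
  shows "\<bar>a\<bar> < 1"
    and "cube_exp n (slice n 1 u) = cube_exp (Suc n) u * (1 + a)"
    and "cube_exp n (slice n (-1) u) = cube_exp (Suc n) u * (1 - a)"
    and "k \<le> n \<Longrightarrow> bias (Suc n) u k =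
      (1 + a) / 2 * bias n (slice n 1 u) k + (1 - a) / 2 * bias n (slice n (-1) u) k"
proof -
  define p q where "p = cube_exp n (slice n 1 u)" and "q = cube_exp n (slice n (-1) u)"
  have E: "cube_exp (Suc n) u = (p + q) / 2" by (simp add: p_def q_def cube_exp_Suc)
  have half: "x / 2 / (y / 2) = x / y" for x y :: real by simp
  have a: "a = (p - q) / (p + q)"
    unfolding a_def bias_def E cube_exp_deriv_last p_def[symmetric] q_def[symmetric] half ..
  have pq: "0 < p" "0 < q" using pos by (simp_all add: p_def q_def)
  show "\<bar>a\<bar> < 1" using pq by (simp add: a abs_divide)
  show p: "cube_exp n (slice n 1 u) = cube_exp (Suc n) u * (1 + a)"
    using pq unfolding E p_def[symmetric] by (simp add: a field_simps)
  show q: "cube_exp n (slice n (-1) u) = cube_exp (Suc n) u * (1 - a)"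
    using pq unfolding E q_def[symmetric] by (simp add: a field_simps)
  show "bias (Suc n) u k =
      (1 + a) / 2 * bias n (slice n 1 u) k + (1 - a) / 2 * bias n (slice n (-1) u) k" if "k \<le> n"
  proof -
    have nz: "p \<noteq> 0" "q \<noteq> 0" using pq by auto
    have weights: "(1 + a) / 2 = p / (p + q)" "(1 - a) / 2 = q / (p + q)"
      using pq by (simp_all add: a field_simps)
    show ?thesis
      unfolding bias_def E cube_exp_deriv_Suc[OF that] p_def[symmetric] q_def[symmetric] half weights
      using nz by (simp add: add_divide_distrib)
  qed
qed

text \<open>A one-sided chain rule. The normalized second moment is a weighted mean of
  \<open>(1 + s * a) * (Q s / (p s)\<^sup>2)\<close>; concavity of \<open>ln\<close> separates the
  entropy of the last sign from the divergences of the slices.\<close>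

lemma renyi_Suc:
  assumes pos: "\<And>x. x \<in> cube (Suc n) \<Longrightarrow> 0 < u x"
  defines "a \<equiv> bias (Suc n) u (Suc n)"
  shows "a\<^sup>2 / 4 + (1 + a) / 2 * renyi n (slice n 1 u) + (1 - a) / 2 * renyi n (slice n (-1) u)
    \<le> renyi (Suc n) u"
proof -
  define p where "p s = cube_exp n (slice n s u)" for s
  define Q where "Q s = cube_exp n (\<lambda>x. (slice n s u x)\<^sup>2)" for s
  define E where "E = cube_exp (Suc n) u"
  have spos: "0 < slice n s u x" if "x \<in> cube n" "s = 1 \<or> s = -1" for s x
    using that by (intro slice_cube[where P = "\<lambda>y. 0 < y"] pos)
  have p: "0 < p s" and Q: "0 < Q s" if "s = 1 \<or> s = -1" for s
    unfolding p_def Q_def using that by (auto intro!: cube_exp_pos dest: spos)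
  have E: "0 < E" unfolding E_def by (intro cube_exp_pos pos)
  have bias: "\<bar>a\<bar> < 1" "p 1 = E * (1 + a)" "p (-1) = E * (1 - a)"
    using bias_Suc(1-3)[of n u] p[of 1] p[of "-1"] by (simp_all add: p_def E_def a_def)
  define w where "w s = (1 + s * a) / 2" for s
  define X where "X s = (1 + s * a) * (Q s / (p s)\<^sup>2)" for s
  have "(\<Sum>s\<in>{1,-1}. w s * ln (X s)) \<le> ln (\<Sum>s\<in>{1,-1}. w s * X s)"
  proof (rule jensen_ln)
    show "sum w {1, -1} = 1" by (simp add: w_def field_simps)
    show "0 < w s" if "s \<in> {1, -1}" for s using that bias(1) by (auto simp: w_def)
    show "0 < X s" if "s \<in> {1, -1}" for s
    proof -
      have "0 < 1 + s * a" "0 < p s" "0 < Q s" using that bias(1) p[of s] Q[of s] by auto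
      then show ?thesis by (simp add: X_def)
    qed
  qed simp
  moreover have "(\<Sum>s\<in>{1,-1}. w s * X s) = cube_exp (Suc n) (\<lambda>x. (u x)\<^sup>2) / (cube_exp (Suc n) u)\<^sup>2"
  proof -
    have sq: "cube_exp (Suc n) (\<lambda>x. (u x)\<^sup>2) = (Q 1 + Q (-1)) / 2"
      by (simp add: cube_exp_Suc Q_def slice_def)
    have "w s * X s = Q s / (2 * E\<^sup>2)" if "s = 1 \<or> s = -1" for s
    proof -
      have "1 + s * a \<noteq> 0" "p s = E * (1 + s * a)" using that bias by auto
      then show ?thesis using E by (simp add: w_def X_def power2_eq_square)
    qed
    then show ?thesis unfolding sq E_def[symmetric] by (simp add: add_divide_distrib)
  qed
  moreover have "ln (X s) = ln (1 + s * a) + renyi n (slice n s u)" if "s = 1 \<or> s = -1" for s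
  proof -
    have "0 < 1 + s * a" "0 < Q s / (p s)\<^sup>2" using that bias(1) p[OF that] Q[OF that] by auto
    then show ?thesis
      unfolding X_def renyi_def Q_def[symmetric] p_def[symmetric] by (subst ln_mult) auto
  qed
  ultimately show ?thesis
    using binary_entropy_ge[OF bias(1)] by (simp add: w_def renyi_def[of "Suc n"] distrib_left)
qed

text \<open>Induction on the dimension: couple the last signs by \<open>corr_weight\<close>, use the
  hypothesis on the slices and combine by Jensen. The squared biases strengthen the induction
  hypothesis: those of the slices absorb the variances lost in
  \<open>corr_weight_product\<close>.\<close>

lemma ln_noise_form_ge:
  assumes \<rho>: "0 \<le> \<rho>" "\<rho> \<le> 1/4"
    and "\<And>x. x \<in> cube n \<Longrightarrow> 0 < u x" "\<And>x. x \<in> cube n \<Longrightarrow> 0 < v x"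
  defines "r \<equiv> \<rho> / (1 - \<rho>\<^sup>2)"
  shows "0 < noise_form \<rho> n u v"
    and "ln (cube_exp n u) + ln (cube_exp n v) + r * (\<Sum>k=1..n. bias n u k * bias n v k)
      - r * \<rho> * (8 * renyi n u - (\<Sum>k=1..n. (bias n u k)\<^sup>2) / 2)
      - r * \<rho> * (8 * renyi n v - (\<Sum>k=1..n. (bias n v k)\<^sup>2) / 2)
      \<le> ln (noise_form \<rho> n u v)"
proof -
  have r: "0 \<le> r"
    using \<rho> power_mono[of \<rho> "1/4" 2] by (simp add: r_def power2_eq_square)
  have "0 < noise_form \<rho> n u v \<and>
    ln (cube_exp n u) + ln (cube_exp n v) + r * (\<Sum>k=1..n. bias n u k * bias n v k)
      - r * \<rho> * (8 * renyi n u - (\<Sum>k=1..n. (bias n u k)\<^sup>2) / 2)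
      - r * \<rho> * (8 * renyi n v - (\<Sum>k=1..n. (bias n v k)\<^sup>2) / 2)
      \<le> ln (noise_form \<rho> n u v)"
    using assms(3,4)
  proof (induction n arbitrary: u v)
    case 0
    then show ?case by (simp add: cube_exp_0 renyi_def cube_def ln_mult power2_eq_square)
  next
    case (Suc n)
    define I where "I = {1, -1::real}"
    define a b where "a = bias (Suc n) u (Suc n)" and "b = bias (Suc n) v (Suc n)"
    define B where "B s t = noise_form \<rho> n (slice n s u) (slice n t v)" for s t
    define F where "F s = renyi n (slice n s u)" for s
    define G where "G s = renyi n (slice n s v)" for s
    define S where "S s = (\<Sum>k=1..n. (bias n (slice n s u) k)\<^sup>2)" for s
    define T where "T s = (\<Sum>k=1..n. (bias n (slice n s v) k)\<^sup>2)" for s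
    define P where "P s t = (\<Sum>k=1..n. bias n (slice n s u) k * bias n (slice n t v) k)" for s t
    define p where "p s = cube_exp n (slice n s u)" for s
    define q where "q s = cube_exp n (slice n s v)" for s
    define E E' where "E = cube_exp (Suc n) u" and "E' = cube_exp (Suc n) v"
    define w where "w = corr_weight \<rho> a b"
    define P0 where "P0 = (\<Sum>k=1..n. bias (Suc n) u k * bias (Suc n) v k)"
    define S0 where "S0 = (\<Sum>k=1..n. (bias (Suc n) u k)\<^sup>2)"
    define T0 where "T0 = (\<Sum>k=1..n. (bias (Suc n) v k)\<^sup>2)"
    have [simp]: "s \<in> I \<longleftrightarrow> s = 1 \<or> s = -1" for s by (auto simp: I_def)
    have pos: "0 < slice n s u x" "0 < slice n s v x" if "s \<in> I" "x \<in> cube n" for s x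
      using that Suc.prems by (auto intro!: slice_cube[where P = "\<lambda>y. 0 < y"])
    have pq: "0 < p s" "0 < q s" if "s \<in> I" for s
      unfolding p_def q_def using pos[OF that] by (auto intro!: cube_exp_pos)
    have EE: "0 < E" "0 < E'"
      unfolding E_def E'_def by (auto intro!: cube_exp_pos Suc.prems)
    have a: "\<bar>a\<bar> < 1" and ps: "\<And>s. s \<in> I \<Longrightarrow> p s = E * (1 + s * a)"
      using bias_Suc(1-3)[of n u] pq[of 1] pq[of "-1"] by (auto simp: p_def E_def a_def)
    have b: "\<bar>b\<bar> < 1" and qs: "\<And>s. s \<in> I \<Longrightarrow> q s = E' * (1 + s * b)"
      using bias_Suc(1-3)[of n v] pq[of 1] pq[of "-1"] by (auto simp: q_def E'_def b_def)
    have IH: "0 < B s t" "ln (p s) + ln (q t) + r * P s t - r * \<rho> * (8 * F s - S s / 2)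
        - r * \<rho> * (8 * G t - T t / 2) \<le> ln (B s t)" if "s \<in> I" "t \<in> I" for s t
      using Suc.IH[of "slice n s u" "slice n t v"] pos that
      unfolding B_def p_def q_def P_def F_def G_def S_def T_def by blast+
    have w: "0 < w s t" if "s \<in> I" "t \<in> I" for s t
      unfolding w_def using that by (intro corr_weight_pos \<rho> a b) auto
    have wI: "w 1 1 + w 1 (-1) = (1 + a) / 2" "w (-1) 1 + w (-1) (-1) = (1 - a) / 2"
      "w 1 1 + w (-1) 1 = (1 + b) / 2" "w 1 (-1) + w (-1) (-1) = (1 - b) / 2"
      using corr_weight_marginals[of \<rho> a b] by (simp_all add: w_def)
    \<comment> \<open>Normalized so that the mean of \<open>X\<close> under the coupling is exactly
      the noise form.\<close>
    define X where "X s t = (1 + \<rho> * s * t) / (4 * w s t) * B s t" for s t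
    have fac: "0 < 1 + \<rho> * s * t" if "s \<in> I" "t \<in> I" for s t
      using that \<rho> by auto
    have X: "0 < X s t" if "s \<in> I" "t \<in> I" for s t
      unfolding X_def using w[OF that] fac[OF that] IH(1)[OF that] by simp
    \<comment> \<open>By \<open>ln y \<le> y - 1\<close> this is a lower bound for the log-ratio of
      the noise weight to the correlation factor of the coupling.\<close>
    define C where "C s t = 1 - (1 + \<rho> * (s - a) * (t - b)) / (1 + \<rho> * s * t)" for s t
    have lnX: "ln E + ln E' + C s t + r * P s t - r * \<rho> * (8 * F s - S s / 2)
        - r * \<rho> * (8 * G t - T t / 2) \<le> ln (X s t)" if "s \<in> I" "t \<in> I" for s t
    proof -
      define c where "c = 1 + \<rho> * (s - a) * (t - b)"
      have c: "0 < c" unfolding c_def using that by (intro corr_factor_pos \<rho> a b) auto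
      have "ln (c / (1 + \<rho> * s * t)) \<le> c / (1 + \<rho> * s * t) - 1"
        using c fac[OF that] by (intro ln_le_minus_one) auto
      then have 1: "C s t \<le> ln (1 + \<rho> * s * t) - ln c"
        using c fac[OF that] by (simp add: ln_div C_def c_def)
      have sa: "0 < 1 + s * a" "0 < 1 + t * b" using that a b by auto
      have "(1 + \<rho> * s * t) / (4 * w s t) = (1 + \<rho> * s * t) / ((1 + s * a) * (1 + t * b) * c)"
        by (simp add: w_def corr_weight_def c_def)
      then have 2: "ln (X s t) = ln (1 + \<rho> * s * t) - (ln (1 + s * a) + ln (1 + t * b) + ln c) + ln (B s t)"
        using c fac[OF that] sa IH(1)[OF that] unfolding X_def by (simp add: ln_mult ln_div)
      have 3: "ln (p s) = ln E + ln (1 + s * a)" "ln (q t) = ln E' + ln (1 + t * b)"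
        unfolding ps[OF that(1)] qs[OF that(2)] using EE sa by (simp_all add: ln_mult)
      show ?thesis using IH(2)[OF that] 1 2 3 by linarith
    qed
    have form: "noise_form \<rho> (Suc n) u v = (\<Sum>s\<in>I. \<Sum>t\<in>I. w s t * X s t)"
    proof -
      have "w s t * X s t = (1 + \<rho> * s * t) * B s t / 4" if "s \<in> I" "t \<in> I" for s t
        using w[OF that] by (simp add: X_def)
      then have "(\<Sum>s\<in>I. \<Sum>t\<in>I. w s t * X s t) = (\<Sum>s\<in>I. \<Sum>t\<in>I. (1 + \<rho> * s * t) * B s t / 4)"
        by (intro sum.cong refl)
      then show ?thesis by (simp add: I_def B_def field_simps)
    qed
    have sum1: "(\<Sum>s\<in>I. \<Sum>t\<in>I. w s t) = 1"
      using wI by (simp add: I_def field_simps)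
    have jensen: "(\<Sum>s\<in>I. \<Sum>t\<in>I. w s t * ln (X s t)) \<le> ln (noise_form \<rho> (Suc n) u v)"
    proof -
      have "(\<Sum>z\<in>I \<times> I. w (fst z) (snd z) * ln (X (fst z) (snd z))) \<le>
          ln (\<Sum>z\<in>I \<times> I. w (fst z) (snd z) * X (fst z) (snd z))"
      proof (rule jensen_ln)
        show "(\<Sum>z\<in>I \<times> I. w (fst z) (snd z)) = 1"
          using sum1 by (simp only: sum.cartesian_product case_prod_unfold)
        show "finite (I \<times> I)" by (simp add: I_def)
      qed (use w X in \<open>auto simp del: \<open>\<And>s. s \<in> I \<longleftrightarrow> s = 1 \<or> s = -1\<close>\<close>)
      then show ?thesis by (simp only: form sum.cartesian_product case_prod_unfold)
    qed
    have cost: "r * (a * b - 3/2 * \<rho> * (a\<^sup>2 + b\<^sup>2)) \<le> (\<Sum>s\<in>I. \<Sum>t\<in>I. w s t * C s t)"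
      unfolding r_def w_def C_def I_def by (intro corr_weight_cost \<rho> a b)
    \<comment> \<open>For each earlier coordinate, the biases conditional on the last signs average
      to the full biases; \<open>corr_weight_product\<close> applies to each and is summed.\<close>
    have prod: "P0 - \<rho> / 2 * ((1 + a) / 2 * S 1 + (1 - a) / 2 * S (-1) - S0
        + ((1 + b) / 2 * T 1 + (1 - b) / 2 * T (-1) - T0)) \<le> (\<Sum>s\<in>I. \<Sum>t\<in>I. w s t * P s t)"
    proof -
      define x where "x k s = bias n (slice n s u) k" for k s
      define y where "y k s = bias n (slice n s v) k" for k s
      have xk: "bias (Suc n) u k = (1 + a) / 2 * x k 1 + (1 - a) / 2 * x k (-1)"
        "bias (Suc n) v k = (1 + b) / 2 * y k 1 + (1 - b) / 2 * y k (-1)" if "k \<in> {1..n}" for k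
        using bias_Suc(4)[of n u k] bias_Suc(4)[of n v k] pq[of 1] pq[of "-1"] that
        by (auto simp: p_def q_def x_def y_def a_def b_def)
      have "(\<Sum>k=1..n. bias (Suc n) u k * bias (Suc n) v k - \<rho> / 2 *
          ((1 + a) / 2 * (x k 1)\<^sup>2 + (1 - a) / 2 * (x k (-1))\<^sup>2 - (bias (Suc n) u k)\<^sup>2
        + ((1 + b) / 2 * (y k 1)\<^sup>2 + (1 - b) / 2 * (y k (-1))\<^sup>2 - (bias (Suc n) v k)\<^sup>2)))
        \<le> (\<Sum>k=1..n. \<Sum>s\<in>I. \<Sum>t\<in>I. w s t * (x k s * y k t))"
      proof (rule sum_mono, goal_cases)
        case (1 k)
        then show ?case unfolding w_def I_def xk[OF 1]
          by (intro corr_weight_product \<rho> a b)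
      qed
      also have "\<dots> = (\<Sum>s\<in>I. \<Sum>t\<in>I. w s t * P s t)"
        unfolding P_def x_def y_def sum_distrib_left
        by (subst sum.swap, intro sum.cong refl, subst sum.swap, intro sum.cong refl)
      finally show ?thesis
        unfolding P0_def S0_def T0_def S_def T_def x_def y_def
        by (simp only: sum_subtractf sum.distrib flip: sum_distrib_left)
    qed
    have R: "a\<^sup>2 / 4 + (1 + a) / 2 * F 1 + (1 - a) / 2 * F (-1) \<le> renyi (Suc n) u"
      "b\<^sup>2 / 4 + (1 + b) / 2 * G 1 + (1 - b) / 2 * G (-1) \<le> renyi (Suc n) v"
      unfolding F_def G_def a_def b_def by (intro renyi_Suc Suc.prems; assumption)+
    have "(\<Sum>s\<in>I. \<Sum>t\<in>I. w s t * (ln E + ln E' + C s t + r * P s t - r * \<rho> * (8 * F s - S s / 2)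
        - r * \<rho> * (8 * G t - T t / 2))) \<le> (\<Sum>s\<in>I. \<Sum>t\<in>I. w s t * ln (X s t))"
    proof (intro sum_mono)
      fix s t assume st: "s \<in> I" "t \<in> I"
      show "w s t * (ln E + ln E' + C s t + r * P s t - r * \<rho> * (8 * F s - S s / 2)
        - r * \<rho> * (8 * G t - T t / 2)) \<le> w s t * ln (X s t)"
        using lnX[OF st] w[OF st] by (intro mult_left_mono) auto
    qed
    moreover have "(\<Sum>s\<in>I. \<Sum>t\<in>I. w s t * (ln E + ln E' + C s t + r * P s t - r * \<rho> * (8 * F s - S s / 2)
        - r * \<rho> * (8 * G t - T t / 2))) =
      (ln E + ln E') * (\<Sum>s\<in>I. \<Sum>t\<in>I. w s t) + (\<Sum>s\<in>I. \<Sum>t\<in>I. w s t * C s t)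
      + r * (\<Sum>s\<in>I. \<Sum>t\<in>I. w s t * P s t)
      - r * \<rho> * ((w 1 1 + w 1 (-1)) * (8 * F 1 - S 1 / 2) + (w (-1) 1 + w (-1) (-1)) * (8 * F (-1) - S (-1) / 2))
      - r * \<rho> * ((w 1 1 + w (-1) 1) * (8 * G 1 - T 1 / 2) + (w 1 (-1) + w (-1) (-1)) * (8 * G (-1) - T (-1) / 2))"
      by (simp add: I_def) (simp add: algebra_simps)
    moreover have "r * (P0 - \<rho> / 2 * ((1 + a) / 2 * S 1 + (1 - a) / 2 * S (-1) - S0
        + ((1 + b) / 2 * T 1 + (1 - b) / 2 * T (-1) - T0))) \<le> r * (\<Sum>s\<in>I. \<Sum>t\<in>I. w s t * P s t)"
      by (intro mult_left_mono prod r)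
    moreover have "r * \<rho> * (8 * (a\<^sup>2 / 4 + (1 + a) / 2 * F 1 + (1 - a) / 2 * F (-1))) \<le> r * \<rho> * (8 * renyi (Suc n) u)"
      "r * \<rho> * (8 * (b\<^sup>2 / 4 + (1 + b) / 2 * G 1 + (1 - b) / 2 * G (-1))) \<le> r * \<rho> * (8 * renyi (Suc n) v)"
      using R r \<rho> by (intro mult_left_mono; simp)+
    \<comment> \<open>The constant 8 balances here: the entropy gain \<open>8 / 4 = 2\<close> per
      \<open>a\<^sup>2\<close> covers 3/2 from \<open>cost\<close> and 1/2 for the new squared
      bias.\<close>
    ultimately have "ln E + ln E' + r * (P0 + a * b)
      - r * \<rho> * (8 * renyi (Suc n) u - (S0 + a\<^sup>2) / 2)
      - r * \<rho> * (8 * renyi (Suc n) v - (T0 + b\<^sup>2) / 2) \<le> ln (noise_form \<rho> (Suc n) u v)"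
      using jensen cost unfolding sum1 wI by (simp add: algebra_simps add_divide_distrib diff_divide_distrib)
    moreover have "0 < noise_form \<rho> (Suc n) u v"
      unfolding form using w X by (intro sum_pos mult_pos_pos) (auto simp: I_def)
    ultimately show ?case
      by (simp add: E_def E'_def P0_def S0_def T0_def a_def b_def)
  qed
  then show "0 < noise_form \<rho> n u v"
    and "ln (cube_exp n u) + ln (cube_exp n v) + r * (\<Sum>k=1..n. bias n u k * bias n v k)
      - r * \<rho> * (8 * renyi n u - (\<Sum>k=1..n. (bias n u k)\<^sup>2) / 2)
      - r * \<rho> * (8 * renyi n v - (\<Sum>k=1..n. (bias n v k)\<^sup>2) / 2)
      \<le> ln (noise_form \<rho> n u v)" by blast+
qed

section \<open>Energy bounds and the lower bound for one coordinate\<close>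

text \<open>The sum is the derivative of \<open>\<phi>\<close>, which is convex for nonnegative
  correlation. Hence \<open>1 - \<sigma>\<close> times it is at most
  \<open>\<phi> 1 - \<phi> 0\<close>, the variance of a 0-1 valued function.\<close>

lemma sum_noise_form_deriv_le:
  assumes f: "f \<in> cube n \<rightarrow> {0, 1}" and \<sigma>: "0 \<le> \<sigma>" "\<sigma> < 1"
  shows "(\<Sum>i=1..n. noise_form \<sigma> n (discrete_deriv i f) (discrete_deriv i f)) \<le> 1 / (4 * (1 - \<sigma>))"
proof -
  define D where "D \<rho> = (\<Sum>i=1..n. noise_form \<rho> n (discrete_deriv i f) (discrete_deriv i f))" for \<rho>
  define \<phi> where "\<phi> \<rho> = noise_form \<rho> n f f" for \<rho>
  have deriv: "(\<phi> has_real_derivative D \<rho>) (at \<rho>)" for \<rho>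
    unfolding D_def \<phi>_def by (rule noise_form_deriv)
  have mono: "D \<rho> \<le> D \<rho>'" if "0 \<le> \<rho>" "\<rho> \<le> \<rho>'" for \<rho> \<rho>'
  proof (rule DERIV_nonneg_imp_nondecreasing[OF that(2)])
    fix x assume "\<rho> \<le> x"
    then have "0 \<le> x" using that by simp
    define D' where "D' = (\<Sum>i=1..n. \<Sum>j=1..n. noise_form x n
      (discrete_deriv j (discrete_deriv i f)) (discrete_deriv j (discrete_deriv i f)))"
    have "(D has_real_derivative D') (at x)"
      unfolding D_def D'_def by (intro DERIV_sum noise_form_deriv)
    moreover have "0 \<le> D'"
      unfolding D'_def by (intro sum_nonneg noise_form_diag_nonneg \<open>0 \<le> x\<close>)
    ultimately show "\<exists>y. (D has_real_derivative y) (at x) \<and> 0 \<le> y" by blast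
  qed
  have "\<phi> 0 \<le> \<phi> \<sigma>"
    using \<sigma>(1)
    by (rule DERIV_nonneg_imp_nondecreasing)
      (auto simp: D_def intro!: exI[of _ "D x" for x] deriv sum_nonneg noise_form_diag_nonneg)
  obtain z where z: "\<sigma> < z" "\<phi> 1 - \<phi> \<sigma> = (1 - \<sigma>) * D z"
    using MVT2[OF \<sigma>(2), of \<phi> D] deriv by blast
  have "(1 - \<sigma>) * D \<sigma> \<le> (1 - \<sigma>) * D z"
    using \<sigma> z by (intro mult_left_mono mono) auto
  also have "\<dots> \<le> \<phi> 1 - \<phi> 0" using z \<open>\<phi> 0 \<le> \<phi> \<sigma>\<close> by simp
  also have "\<dots> = cube_exp n f - (cube_exp n f)\<^sup>2"
  proof -
    have "cube_exp n (\<lambda>x. f x * f x) = cube_exp n f"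
      using f by (intro cube_exp_cong) (auto simp: Pi_iff)
    then show ?thesis by (simp add: \<phi>_def noise_form_0 noise_form_1 power2_eq_square)
  qed
  also have "\<dots> \<le> 1 / 4"
    using zero_le_power2[of "cube_exp n f - 1 / 2"] by (simp add: power2_eq_square algebra_simps)
  finally show ?thesis using \<sigma> unfolding D_def by (simp add: field_simps)
qed

text \<open>Here \<open>m\<close> will be the sum of \<open>p\<close> over all pairs \<open>\<partial>\<^sub>i f\<close>, \<open>\<partial>\<^sub>i g\<close>; the last bracket then sums to at
  most \<open>2 m ln (1 / m)\<close>. It comes from bounding the logarithm by its tangent at \<open>1 / m\<close>.\<close>

lemma noise_form_deriv_ge:
  assumes \<rho>: "0 \<le> \<rho>" "\<rho> \<le> 1/4" and m: "0 < m"
    and f: "\<And>x. x \<in> cube n \<Longrightarrow> 0 \<le> u x" and g: "\<And>x. x \<in> cube n \<Longrightarrow> 0 \<le> v x"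
  defines "r \<equiv> \<rho> / (1 - \<rho>\<^sup>2)" and "p \<equiv> cube_exp n u * cube_exp n v"
  shows "p + r / 4 * (\<Sum>k=1..n. cube_exp n (discrete_deriv k u) * cube_exp n (discrete_deriv k v))
      - 8 * r * \<rho> * (2 * p * ln (1 / m) + m * (noise_form (1/4) n u u + noise_form (1/4) n v v) - 2 * p)
    \<le> noise_form (\<rho> / 4) n u v"
proof -
  define \<alpha> \<beta> where "\<alpha> = cube_exp n u" and "\<beta> = cube_exp n v"
  define A B where "A = noise_form (1/4) n u u" and "B = noise_form (1/4) n v v"
  define W where "W = (\<Sum>k=1..n. cube_exp n (discrete_deriv k u) * cube_exp n (discrete_deriv k v))"
  have p: "p = \<alpha> * \<beta>" by (simp add: p_def \<alpha>_def \<beta>_def)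
  have r: "0 \<le> r"
    using \<rho> power_mono[of \<rho> "1/4" 2] by (simp add: r_def power2_eq_square)
  have AB0: "0 \<le> A" "0 \<le> B" by (simp_all add: A_def B_def noise_form_diag_nonneg)
  have \<alpha>\<beta>0: "0 \<le> \<alpha>" "0 \<le> \<beta>" unfolding \<alpha>_def \<beta>_def by (intro cube_exp_nonneg f g; assumption)+
  have "p + r / 4 * W - 8 * r * \<rho> * (2 * p * ln (1 / m) + m * (A + B) - 2 * p) \<le> noise_form (\<rho> / 4) n u v"
  proof (cases "\<alpha> = 0 \<or> \<beta> = 0")
    \<comment> \<open>One of the functions vanishes on the cube, so only the nonpositive error term
      remains on the left.\<close>
    case True
    have zero: "cube_exp n (discrete_deriv k w) = 0"
      if "\<And>x. x \<in> cube n \<Longrightarrow> 0 \<le> w x" "cube_exp n w = 0" "k \<in> {1..n}" for w k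
    proof -
      have "cube_exp n (discrete_deriv k w) = cube_exp n (\<lambda>_. 0)"
        unfolding discrete_deriv_def
        using cube_exp_eq_0_imp[OF that(1,2)] fun_upd_in_cube[OF _ that(3)]
        by (intro cube_exp_cong) auto
      then show ?thesis by (simp add: cube_exp_eq_sum)
    qed
    have "W = 0" unfolding W_def
      using True zero[OF f] zero[OF g] by (intro sum.neutral) (auto simp: \<alpha>_def \<beta>_def)
    moreover have "p = 0" using True by (auto simp: p)
    moreover have "0 \<le> noise_form (\<rho> / 4) n u v" using \<rho> f g by (intro noise_form_nonneg) auto
    moreover have "0 \<le> 8 * r * \<rho> * (m * (A + B))" using r \<rho> m AB0 by simp
    moreover have "p + r / 4 * W - 8 * r * \<rho> * (2 * p * ln (1 / m) + m * (A + B) - 2 * p)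
        = - (8 * r * \<rho> * (m * (A + B)))"
      unfolding \<open>W = 0\<close> \<open>p = 0\<close> by simp
    ultimately show ?thesis by linarith
  next
    case False
    then have \<alpha>\<beta>: "0 < \<alpha>" "0 < \<beta>" using \<alpha>\<beta>0 by auto
    \<comment> \<open>Smoothing both functions by 1/2 yields all the factors 1/4: in the
      correlation, in the products of biases, and in the noise parameter of the second
      moments.\<close>
    define U V where "U = noise_op (1/2) n u" and "V = noise_op (1/2) n v"
    have pos: "0 < noise_op (1/2) n w x"
      if "\<And>x. x \<in> cube n \<Longrightarrow> 0 \<le> w x" "0 < cube_exp n w" "x \<in> cube n" for w x
    proof -
      have "0 < (1 - 1/2) ^ n * cube_exp n w" using that(2) by simp
      also have "\<dots> \<le> noise_op (1/2) n w x"
        using that by (intro noise_op_ge) (auto simp: cube_def)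
      finally show ?thesis .
    qed
    have UV: "0 < U x" "0 < V x" if "x \<in> cube n" for x
      using pos[OF f] pos[OF g] that \<alpha>\<beta> by (auto simp: U_def V_def \<alpha>_def \<beta>_def)
    have E: "cube_exp n U = \<alpha>" "cube_exp n V = \<beta>"
      by (simp_all add: U_def V_def \<alpha>_def \<beta>_def cube_exp_noise_op)
    have form: "noise_form \<rho> n U V = noise_form (\<rho> / 4) n u v"
      by (simp add: U_def V_def noise_form_noise_op power2_eq_square)
    have sq: "cube_exp n (\<lambda>x. (U x)\<^sup>2) = A" "cube_exp n (\<lambda>x. (V x)\<^sup>2) = B"
      unfolding power2_eq_square noise_form_1[symmetric]
      by (simp_all add: U_def V_def A_def B_def noise_form_noise_op power2_eq_square)
    have AB: "0 < A" "0 < B"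
      unfolding sq[symmetric] using UV by (auto intro!: cube_exp_pos simp: less_imp_neq[symmetric])
    define b where "b = (\<Sum>k=1..n. bias n U k * bias n V k)"
    have pb: "p * b = W / 4"
      unfolding p b_def W_def sum_distrib_left sum_divide_distrib
      using \<alpha>\<beta> by (intro sum.cong refl)
        (simp add: bias_def E, simp add: U_def V_def cube_exp_deriv_noise_op)
    define R where "R = renyi n U + renyi n V"
    have R: "R = 2 * ln (sqrt (A * B) / p)"
      using \<alpha>\<beta> AB unfolding R_def renyi_def sq E p
      by (simp add: ln_div ln_mult ln_sqrt ln_realpow)
    \<comment> \<open>The final AM-GM separates \<open>u\<close> from \<open>v\<close>, leaving
      energies whose sums \<open>sum_noise_form_deriv_le\<close> controls.\<close>
    have pR: "p * R \<le> 2 * p * ln (1 / m) + m * (A + B) - 2 * p"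
    proof -
      have ABp: "0 < sqrt (A * B)" "0 < p" using AB \<alpha>\<beta> by (simp_all add: p)
      have "ln (m * sqrt (A * B) / p) \<le> m * sqrt (A * B) / p - 1"
        using ABp m by (intro ln_le_minus_one) simp
      moreover have "ln (m * x / p) = ln (x / p) - ln (1 / m)" if "0 < x" for x
        using that ABp m by (simp add: ln_div ln_mult)
      from this[OF ABp(1)] have "ln (m * sqrt (A * B) / p) = ln (sqrt (A * B) / p) - ln (1 / m)" .
      ultimately have "p * R \<le> p * (2 * (ln (1 / m) + m * sqrt (A * B) / p - 1))"
        using ABp unfolding R by (intro mult_left_mono) auto
      also have "\<dots> = 2 * p * ln (1 / m) + m * (2 * sqrt (A * B)) - 2 * p"
        using ABp by (simp add: field_simps)
      also have "m * (2 * sqrt (A * B)) \<le> m * (A + B)"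
        using arith_geo_mean_sqrt[of A B] AB m by (intro mult_left_mono) auto
      finally show ?thesis by simp
    qed
    have r\<rho>: "0 \<le> r * \<rho>" using r \<rho> by simp
    note key = ln_noise_form_ge[OF \<rho>, of n U V, folded r_def, unfolded E, OF UV, folded b_def]
    have "0 \<le> r * \<rho> * ((\<Sum>k=1..n. (bias n U k)\<^sup>2) / 2)" "0 \<le> r * \<rho> * ((\<Sum>k=1..n. (bias n V k)\<^sup>2) / 2)"
      using r\<rho> by (auto intro!: mult_nonneg_nonneg sum_nonneg)
    then have "ln p + (r * b - 8 * r * \<rho> * R) \<le> ln (noise_form \<rho> n U V)"
      using key(2) \<alpha>\<beta> by (simp add: p ln_mult R_def algebra_simps)
    then have "exp (ln p + (r * b - 8 * r * \<rho> * R)) \<le> exp (ln (noise_form \<rho> n U V))"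
      by simp
    then have "p * exp (r * b - 8 * r * \<rho> * R) \<le> noise_form \<rho> n U V"
      using key(1) \<alpha>\<beta> by (simp only: exp_add exp_ln p mult_pos_pos)
    \<comment> \<open>Linearizing the exponential gives a bound that can be summed over the
      coordinates.\<close>
    moreover have "p * (1 + (r * b - 8 * r * \<rho> * R)) \<le> p * exp (r * b - 8 * r * \<rho> * R)"
      using \<alpha>\<beta> by (intro mult_left_mono exp_ge_add_one_self) (simp add: p)
    moreover have "8 * r * \<rho> * (p * R) \<le> 8 * r * \<rho> * (2 * p * ln (1 / m) + m * (A + B) - 2 * p)"
      using pR r \<rho> by (intro mult_left_mono) auto
    moreover have "p * (1 + (r * b - 8 * r * \<rho> * R)) = p + r * (p * b) - 8 * r * \<rho> * (p * R)"
      by (simp add: algebra_simps)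
    ultimately show ?thesis unfolding pb form by simp
  qed
  then show ?thesis unfolding A_def B_def W_def .
qed

section \<open>The correlation inequality\<close>

text \<open>On \<open>[0, \<delta> / 4]\<close> the derivative \<open>h\<close> is at least
  \<open>m / 2\<close> with \<open>m = M1 / 4\<close>, which gives the 1/32; afterwards
  \<open>\<phi>\<close> does not decrease. The two conditions on \<open>\<delta>\<close> control the
  quadratic error and the linear term with \<open>M2\<close>.\<close>

lemma correlation_ge:
  assumes f: "f \<in> cube n \<rightarrow> {0, 1}" "cube_increasing n f"
    and g: "g \<in> cube n \<rightarrow> {0, 1}" "cube_increasing n g"
  shows "0 \<le> M1 n f g" and "M1 n f g \<le> 1" and "0 \<le> Cor n f g"
    and "0 < M1 n f g \<Longrightarrow> 0 < \<delta> \<Longrightarrow> 20 * \<delta> * sqrt (ln (exp 1 / M1 n f g)) \<le> 1 \<Longrightarrow>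
      20 * \<delta> * \<bar>M2 n f g\<bar> \<le> M1 n f g \<Longrightarrow> \<delta> * M1 n f g / 32 \<le> Cor n f g"
proof -
  define u v where "u i = discrete_deriv i f" and "v i = discrete_deriv i g" for i
  define \<phi> where "\<phi> \<rho> = noise_form \<rho> n f g" for \<rho>
  define h where "h \<rho> = (\<Sum>i=1..n. noise_form \<rho> n (u i) (v i))" for \<rho>
  define A where "A \<rho> = (\<Sum>i=1..n. noise_form \<rho> n (u i) (u i))" for \<rho>
  define B where "B \<rho> = (\<Sum>i=1..n. noise_form \<rho> n (v i) (v i))" for \<rho>
  define m where "m = (\<Sum>i=1..n. cube_exp n (u i) * cube_exp n (v i))"
  have uv: "0 \<le> u i x" "0 \<le> v i x" if "i \<in> {1..n}" "x \<in> cube n" for i x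
    using f g that by (auto simp: cube_increasing_def u_def v_def)
  have M1: "M1 n f g = 4 * m"
  proof -
    have "influence n i f = 2 * cube_exp n (u i)" "influence n i g = 2 * cube_exp n (v i)"
      if "i \<in> {1..n}" for i
      unfolding influence_def u_def[symmetric] v_def[symmetric]
      using uv[OF that] by (auto intro!: cube_exp_cong)
    then show ?thesis by (simp add: M1_def m_def sum_distrib_left)
  qed
  have deriv: "(\<phi> has_real_derivative h \<rho>) (at \<rho>)" for \<rho>
    unfolding \<phi>_def h_def u_def v_def by (rule noise_form_deriv)
  have h0: "0 \<le> h \<rho>" if "0 \<le> \<rho>" "\<rho> \<le> 1" for \<rho>
    unfolding h_def using that by (intro sum_nonneg noise_form_nonneg uv) auto
  have mono: "\<phi> \<rho> \<le> \<phi> 1" if "0 \<le> \<rho>" "\<rho> \<le> 1" for \<rho>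
    using that(2)
  proof (rule DERIV_nonneg_imp_nondecreasing)
    fix x assume "\<rho> \<le> x" "x \<le> 1"
    then show "\<exists>y. (\<phi> has_real_derivative y) (at x) \<and> 0 \<le> y" using deriv h0[of x] that by auto
  qed
  have Cor: "Cor n f g = \<phi> 1 - \<phi> 0" by (simp add: Cor_def \<phi>_def noise_form_1 noise_form_0)
  show "0 \<le> Cor n f g" using mono[of 0] by (simp add: Cor)
  have "0 \<le> m" unfolding m_def by (intro sum_nonneg mult_nonneg_nonneg cube_exp_nonneg uv)
  then show "0 \<le> M1 n f g" by (simp add: M1)
  have AB: "A \<rho> \<le> 1 / (4 * (1 - \<rho>))" "B \<rho> \<le> 1 / (4 * (1 - \<rho>))" if "0 \<le> \<rho>" "\<rho> < 1" for \<rho>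
    unfolding A_def B_def u_def v_def by (intro sum_noise_form_deriv_le f g that)+
  have amgm: "x * y \<le> (x * x + y * y) / 2" for x y :: real
    using sum_squares_bound[of x y] by (simp add: power2_eq_square)
  have "m \<le> (A 0 + B 0) / 2"
    unfolding m_def A_def B_def noise_form_0 sum.distrib[symmetric] sum_divide_distrib
    by (intro sum_mono amgm)
  then have m4: "m \<le> 1/4" using AB[of 0] by simp
  then show "M1 n f g \<le> 1" by (simp add: M1)
  assume "0 < M1 n f g" and \<delta>: "0 < \<delta>"
    and \<delta>1: "20 * \<delta> * sqrt (ln (exp 1 / M1 n f g)) \<le> 1"
    and \<delta>2: "20 * \<delta> * \<bar>M2 n f g\<bar> \<le> M1 n f g"
  then have m: "0 < m" by (simp add: M1)
  define L where "L = ln (exp 1 / M1 n f g)"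
  have L: "L = 1 - ln (4 * m)" using m by (simp add: L_def M1 ln_div)
  have "ln (4 * m) \<le> 0" using m m4 by (simp add: ln_le_zero_iff)
  then have L1: "1 \<le> L" by (simp add: L)
  \<comment> \<open>Uses \<open>m = M1 / 4\<close> and that \<open>-ln (4 * m)\<close> is
    nonnegative.\<close>
  have lnm: "ln (1 / m) \<le> 3 * L"
  proof -
    have "ln (4::real) \<le> 3" using ln_le_minus_one[of 4] by simp
    moreover have "ln (1 / m) = ln 4 - ln (4 * m)" using m by (simp add: ln_div ln_mult)
    ultimately show ?thesis using \<open>ln (4 * m) \<le> 0\<close> by (simp add: L)
  qed
  have "1 \<le> sqrt L" using L1 by simp
  then have "20 * \<delta> * 1 \<le> 20 * \<delta> * sqrt L" using \<delta> by (intro mult_left_mono) auto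
  then have \<delta>20: "20 * \<delta> \<le> 1" using \<delta>1 by (simp add: L_def)
  have \<delta>L: "400 * \<delta>\<^sup>2 * L \<le> 1"
  proof -
    have "(20 * \<delta> * sqrt L)\<^sup>2 \<le> 1\<^sup>2"
      using \<delta> \<delta>1 L1 by (intro power_mono) (auto simp: L_def)
    then show ?thesis using L1 by (simp add: power_mult_distrib)
  qed
  have M2: "M2 n f g = (\<Sum>i=1..n. \<Sum>k=1..n. cube_exp n (discrete_deriv k (u i)) * cube_exp n (discrete_deriv k (v i)))"
    unfolding M2_def hs_inner_def V_def u_def v_def by (rule sum.swap)
  \<comment> \<open>The linear and the quadratic error may each consume
    \<open>m / 4\<close>.\<close>
  have h_ge: "m / 2 \<le> h (\<rho> / 4)" if \<rho>: "0 \<le> \<rho>" "\<rho> \<le> \<delta>" for \<rho>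
  proof -
    have \<rho>4: "\<rho> \<le> 1/4" using \<rho> \<delta>20 by simp
    define r where "r = \<rho> / (1 - \<rho>\<^sup>2)"
    have \<rho>2: "\<rho>\<^sup>2 \<le> 1/16" using \<rho> \<rho>4 power_mono[of \<rho> "1/4" 2] by (simp add: power2_eq_square)
    have r: "0 \<le> r" "r \<le> 2 * \<rho>"
    proof -
      show "0 \<le> r" using \<rho> \<rho>2 by (simp add: r_def)
      have "\<rho> / (1 - \<rho>\<^sup>2) \<le> \<rho> / (1/2)" using \<rho> \<rho>2 by (intro divide_left_mono) auto
      then show "r \<le> 2 * \<rho>" by (simp add: r_def)
    qed
    have "(\<Sum>i=1..n. cube_exp n (u i) * cube_exp n (v i)
        + r / 4 * (\<Sum>k=1..n. cube_exp n (discrete_deriv k (u i)) * cube_exp n (discrete_deriv k (v i)))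
        - 8 * r * \<rho> * (2 * (cube_exp n (u i) * cube_exp n (v i)) * ln (1 / m)
            + m * (noise_form (1/4) n (u i) (u i) + noise_form (1/4) n (v i) (v i))
            - 2 * (cube_exp n (u i) * cube_exp n (v i)))) \<le> h (\<rho> / 4)"
      unfolding h_def r_def by (intro sum_mono noise_form_deriv_ge \<rho> \<rho>4 m uv)
    also have "(\<Sum>i=1..n. cube_exp n (u i) * cube_exp n (v i)
        + r / 4 * (\<Sum>k=1..n. cube_exp n (discrete_deriv k (u i)) * cube_exp n (discrete_deriv k (v i)))
        - 8 * r * \<rho> * (2 * (cube_exp n (u i) * cube_exp n (v i)) * ln (1 / m)
            + m * (noise_form (1/4) n (u i) (u i) + noise_form (1/4) n (v i) (v i))
            - 2 * (cube_exp n (u i) * cube_exp n (v i))))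
      = m + r / 4 * M2 n f g - 8 * r * \<rho> * (2 * m * ln (1 / m) + m * (A (1/4) + B (1/4)) - 2 * m)"
      unfolding M2 m_def A_def B_def
      by (simp only: sum_subtractf sum.distrib flip: sum_distrib_left sum_distrib_right)
    finally have h1: "m + r / 4 * M2 n f g
        - 8 * r * \<rho> * (2 * m * ln (1 / m) + m * (A (1/4) + B (1/4)) - 2 * m) \<le> h (\<rho> / 4)" .
    \<comment> \<open>Both energies at 1/4 are at most 1/3, so their contribution is absorbed by
      \<open>- 2 * m\<close>.\<close>
    have "m * (A (1/4) + B (1/4)) \<le> m * 2" using AB[of "1/4"] m by (intro mult_left_mono) auto
    moreover have "m * ln (1 / m) \<le> m * (3 * L)" using lnm m by (intro mult_left_mono) auto
    ultimately have "8 * r * \<rho> * (2 * m * ln (1 / m) + m * (A (1/4) + B (1/4)) - 2 * m)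
        \<le> 8 * r * \<rho> * (6 * (m * L))"
      using r \<rho> by (intro mult_left_mono) auto
    also have "\<dots> \<le> 8 * (2 * \<delta>) * \<delta> * (6 * (m * L))"
      using r \<rho> m L1 \<delta> by (intro mult_right_mono mult_mono) auto
    also have "\<dots> = 96 * \<delta>\<^sup>2 * L * m" by (simp add: power2_eq_square)
    also have "\<dots> \<le> 1 / 4 * m" using \<delta>L m by (intro mult_right_mono) auto
    finally have 1: "8 * r * \<rho> * (2 * m * ln (1 / m) + m * (A (1/4) + B (1/4)) - 2 * m) \<le> 1 / 4 * m" .
    have "\<bar>r / 4 * M2 n f g\<bar> = r / 4 * \<bar>M2 n f g\<bar>" using r by (simp add: abs_mult)
    also have "\<dots> \<le> (2 * \<delta>) / 4 * \<bar>M2 n f g\<bar>" using r \<rho> by (intro mult_right_mono) auto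
    also have "\<dots> \<le> m / 4" using \<delta>2 m by (simp add: M1)
    finally show ?thesis using h1 1 by linarith
  qed
  obtain z where z: "0 < z" "z < \<delta> / 4" "\<phi> (\<delta> / 4) - \<phi> 0 = (\<delta> / 4 - 0) * h z"
    using MVT2[of 0 "\<delta> / 4" \<phi> h] deriv \<delta> by auto
  have "(\<delta> / 4) * (m / 2) \<le> (\<delta> / 4) * h z"
    using h_ge[of "4 * z"] z \<delta> by (intro mult_left_mono) auto
  also have "\<dots> = \<phi> (\<delta> / 4) - \<phi> 0" using z by simp
  also have "\<dots> \<le> Cor n f g" using mono[of "\<delta> / 4"] \<delta> \<delta>20 by (simp add: Cor)
  finally show "\<delta> * M1 n f g / 32 \<le> Cor n f g" by (simp add: M1)
qed

theorem theorem3: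
  "\<exists>c::real. c > 0 \<and>
    (\<forall>(n::nat) (f::(nat \<Rightarrow> real) \<Rightarrow> real) (g::(nat \<Rightarrow> real) \<Rightarrow> real).
      n \<ge> 1 \<longrightarrow> f \<in> cube n \<rightarrow> {0, 1} \<longrightarrow> g \<in> cube n \<rightarrow> {0, 1} \<longrightarrow>
      cube_increasing n f \<longrightarrow> cube_increasing n g \<longrightarrow>
      ereal (Cor n f g) \<ge> ereal c *
        (if M1 n f g = 0 then 0
         else min (ereal (M1 n f g / sqrt (ln (exp 1 / M1 n f g))))
                  (if M2 n f g = 0 then \<infinity> else ereal ((M1 n f g)\<^sup>2 / \<bar>M2 n f g\<bar>))))"
proof (intro exI[of _ "1/640 :: real"] conjI allI impI)
  fix n :: nat and f g :: "(nat \<Rightarrow> real) \<Rightarrow> real"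
  assume "f \<in> cube n \<rightarrow> {0, 1}" "g \<in> cube n \<rightarrow> {0, 1}" "cube_increasing n f" "cube_increasing n g"
  note ge = correlation_ge[OF this(1,3,2,4)]
  define M N S where "M = M1 n f g" and "N = \<bar>M2 n f g\<bar>" and "S = sqrt (ln (exp 1 / M))"
  show "ereal (1/640) *
        (if M1 n f g = 0 then 0
         else min (ereal (M1 n f g / sqrt (ln (exp 1 / M1 n f g))))
                  (if M2 n f g = 0 then \<infinity> else ereal ((M1 n f g)\<^sup>2 / \<bar>M2 n f g\<bar>))) \<le> ereal (Cor n f g)"
  proof (cases "M1 n f g = 0")
    case True
    then show ?thesis using ge(3) by simp
  next
    case False
    then have M: "0 < M" using ge(1) by (simp add: M_def)
    have "0 < ln (exp 1 / M)" using M ge(2) by (simp add: M_def ln_div) (smt (verit) ln_le_zero_iff)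
    then have S: "0 < S" by (simp add: S_def)
    have main: "\<delta> * M / 32 \<le> Cor n f g" if "0 < \<delta>" "20 * \<delta> * S \<le> 1" "20 * \<delta> * N \<le> M" for \<delta>
      using ge(4)[of \<delta>] M that by (simp add: M_def N_def S_def)
    show ?thesis
    proof (cases "M2 n f g = 0")
      case True
      then have "1 / (20 * S) * M / 32 \<le> Cor n f g" using M S by (intro main) (auto simp: N_def)
      then show ?thesis using True False by (simp flip: M_def S_def)
    next
      case False
      then have N: "0 < N" by (simp add: N_def)
      \<comment> \<open>The largest value allowed by both constraints of \<open>main\<close>; its
        factor 1/20 and the 1/32 in \<open>main\<close> give 1/640.\<close>
      define \<delta> where "\<delta> = min (1 / (20 * S)) (M / (20 * N))"
      have "\<delta> * M / 32 \<le> Cor n f g"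
      proof (rule main)
        show "0 < \<delta>" using M N S by (simp add: \<delta>_def)
        have "\<delta> \<le> 1 / (20 * S)" "\<delta> \<le> M / (20 * N)" by (simp_all add: \<delta>_def)
        then show "20 * \<delta> * S \<le> 1" "20 * \<delta> * N \<le> M" using N S by (simp_all add: field_simps)
      qed
      moreover have "\<delta> * M / 32 = 1/640 * min (M / S) (M\<^sup>2 / N)"
      proof -
        have "\<delta> * M = min (1 / (20 * S) * M) (M / (20 * N) * M)"
          unfolding \<delta>_def using M by (intro min_mult_distrib_right[THEN trans]) simp
        also have "\<dots> = min (1/20 * (M / S)) (1/20 * (M\<^sup>2 / N))" by (simp add: power2_eq_square)
        also have "\<dots> = 1/20 * min (M / S) (M\<^sup>2 / N)" by (simp add: min_def)
        finally show ?thesis by (simp add: mult.commute)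
      qed
      ultimately have "ereal (1/640 * min (M / S) (M\<^sup>2 / N)) \<le> ereal (Cor n f g)" by simp
      then show ?thesis
        using False \<open>M1 n f g \<noteq> 0\<close>
        by (simp flip: M_def S_def N_def ereal_min)
    qed
  qed
qed simp

end
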